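(* Let $\mathbf{W}=\mathbf{D}^{-1}\mathbf{K}\in\mathbb{R}^{n\times n}$ be a kernel denoiser, let $\mathbf{A}\in\mathbb{R}^{m\times n}$ be the forward operator corresponding to inpainting, deblurring, or superresolution, and let $\boldsymbol{b}\in\mathbb{R}^m$ and $\lambda>0$. Then the optimization problem $$\min_{\boldsymbol{x}\in\mathbb{R}^n}\ \tfrac12\|\mathbf{A}\boldsymbol{x}-\boldsymbol{b}\|_2^2+\lambda\,\phi_{\mathbf{W}}(\boldsymbol{x})$$ is strongly convex on $(\mathbb{R}^n,\langle\cdot,\cdot\rangle_{\mathbf{D}})$ (that is, its objective function is strongly convex there), where $\phi_{\mathbf{W}}$ is the regularizer associated with $\mathbf{W}$.
   Context: A kernel denoiser is a matrix $\mathbf{W}=\mathbf{D}^{-1}\mathbf{K}$, where $\mathbf{K}\in\mathbb{R}^{n\times n}$ is symmetric positive semidefinite, entrywise nonnegative, with positive diagonal entries, and $\mathbf{D}=\mathrm{diag}(\mathbf{K}\boldsymbol{e})$ with $\boldsymbol{e}$ the all-ones vector. Put $\mathbf{W}_s=\mathbf{D}^{-1/2}\mathbf{K}\mathbf{D}^{-1/2}$ (symmetric with spectrum in $[0,1]$) and $$\varphi_{\mathbf{W}_s}(\boldsymbol{x})=\tfrac12\boldsymbol{x}^\top\mathbf{W}_s^{\dagger}(\mathbf{I}-\mathbf{W}_s)\boldsymbol{x}+\iota_{\mathcal{R}(\mathbf{W}_s)}(\boldsymbol{x}),\qquad \phi_{\mathbf{W}}(\boldsymbol{x})=\varphi_{\mathbf{W}_s}(\mathbf{D}^{1/2}\boldsymbol{x}),$$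 with $^\dagger$ the pseudoinverse, $\mathcal{R}$ the range, and $\iota_\Omega$ equal to $0$ on $\Omega$ and $+\infty$ off $\Omega$. The inner product is $\langle\boldsymbol{x},\boldsymbol{y}\rangle_{\mathbf{D}}=\boldsymbol{x}^\top\mathbf{D}\boldsymbol{y}$. Forward operators (images with $n$ pixels are vectors in $\mathbb{R}^n$). Inpainting: $\mathbf{A}$ is a sampling operator, with at least one pixel sampled. Deblurring: $\mathbf{A}$ is a blur (convolution), the blur being nonnegative and nonzero. Superresolution: $\mathbf{A}$ is the composition of a (lowpass) blur, nonnegative and nonzero, followed by subsampling. A proper, closed, convex function $f:\mathbb{R}^n\to(-\infty,\infty]$ is strongly convex on a Euclidean space $(\mathbb{R}^n,\langle\cdot,\cdot\rangle)$ with induced norm $\|\cdot\|$ if there exists $\mu>0$ such that for all $\boldsymbol{x},\boldsymbol{y}\in\mathbb{R}^n$ and $\theta\in[0,1]$, $$f(\theta\boldsymbol{x}+(1-\theta)\boldsymbol{y})\le\theta f(\boldsymbol{x})+(1-\theta)f(\boldsymbol{y})-\tfrac{\mu}{2}\theta(1-\theta)\|\boldsymbol{x}-\boldsymbol{y}\|^2.$$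
   Formalization: W is assumed irreducible (false without it: K = I, n = 2, inpainting with one sampled pixel gives a zero regularizer and a flat direction); blurs are same-size convolutions with periodic, replicated or mirrored boundaries, not zero padding. *)

theory Defs
  imports "HOL-Analysis.Analysis"
begin

section \<open>Extended-real-valued convex functions\<close>

definition ext_epigraph :: "('a \<Rightarrow> ereal) \<Rightarrow> ('a \<times> real) set" where
  "ext_epigraph f = {(x, r). f x \<le> ereal r}"

definition proper_fun :: "('a \<Rightarrow> ereal) \<Rightarrow> bool" where
  "proper_fun f \<longleftrightarrow> (\<forall>x. f x \<noteq> - \<infinity>) \<and> (\<exists>x. f x \<noteq> \<infinity>)"

definition closed_fun :: "('a::topological_space \<Rightarrow> ereal) \<Rightarrow> bool" where
  "closed_fun f \<longleftrightarrow> closed (ext_epigraph f)"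

definition convex_fun :: "('a::real_vector \<Rightarrow> ereal) \<Rightarrow> bool" where
  "convex_fun f \<longleftrightarrow> convex (ext_epigraph f)"

text \<open>The inner product is an explicit argument, because strong convexity is used with respect to
  inner products other than the standard one. For \<open>\<theta> = 0\<close> or \<open>\<theta> = 1\<close> the right-hand side relies on the
  convention \<open>0 * \<infinity> = 0\<close>, which holds in \<^typ>\<open>ereal\<close>.\<close>

definition ip_norm :: "('a \<Rightarrow> 'a \<Rightarrow> real) \<Rightarrow> 'a \<Rightarrow> real" where
  "ip_norm ip x = sqrt (ip x x)"

definition strongly_convex ::
  "('a::{real_vector, topological_space} \<Rightarrow> 'a \<Rightarrow> real) \<Rightarrow> ('a \<Rightarrow> ereal) \<Rightarrow> bool" where
  "strongly_convex ip f \<longleftrightarrow>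
     proper_fun f \<and> closed_fun f \<and> convex_fun f \<and>
     (\<exists>\<mu>>0. \<forall>x y. \<forall>\<theta>\<in>{0..1}.
        f (\<theta> *\<^sub>R x + (1 - \<theta>) *\<^sub>R y)
          \<le> ereal \<theta> * f x + ereal (1 - \<theta>) * f y
             - ereal (\<mu> / 2 * \<theta> * (1 - \<theta>) * (ip_norm ip (x - y))\<^sup>2))"

definition iota :: "'a set \<Rightarrow> 'a \<Rightarrow> ereal" where
  "iota \<Omega> x = (if x \<in> \<Omega> then 0 else \<infinity>)"

section \<open>The Moore-Penrose pseudoinverse\<close>

definition is_pinv :: "real^'n^'m \<Rightarrow> real^'m^'n \<Rightarrow> bool" where
  "is_pinv A X \<longleftrightarrow>
     A ** X ** A = A \<and> X ** A ** X = X \<and>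
     transpose (A ** X) = A ** X \<and> transpose (X ** A) = X ** A"

definition pinv :: "real^'n^'m \<Rightarrow> real^'m^'n" where
  "pinv A = (THE X. is_pinv A X)"

lemma is_pinv_unique:
  assumes "is_pinv A X" and "is_pinv A Y"
  shows "X = Y"
proof -
  have AX: "A ** X = A ** Y"
  proof -
    have "A ** X = transpose (A ** X)" using assms by (simp add: is_pinv_def)
    also have "\<dots> = transpose ((A ** Y) ** (A ** X))"
      using assms by (simp add: is_pinv_def matrix_mul_assoc)
    also have "\<dots> = (A ** X) ** (A ** Y)"
      using assms by (simp add: is_pinv_def matrix_transpose_mul[of "A ** Y" "A ** X"])
    also have "\<dots> = A ** Y" using assms by (simp add: is_pinv_def matrix_mul_assoc)
    finally show ?thesis .
  qed
  have XA: "X ** A = Y ** A"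
  proof -
    have "X ** A = transpose (X ** A)" using assms by (simp add: is_pinv_def)
    also have "\<dots> = transpose ((X ** A) ** (Y ** A))"
      using assms by (metis is_pinv_def matrix_mul_assoc)
    also have "\<dots> = (Y ** A) ** (X ** A)"
      using assms by (simp add: is_pinv_def matrix_transpose_mul[of "X ** A" "Y ** A"])
    also have "\<dots> = Y ** A" using assms by (metis is_pinv_def matrix_mul_assoc)
    finally show ?thesis .
  qed
  have "X = X ** A ** X" using assms by (simp add: is_pinv_def)
  also have "\<dots> = Y ** A ** Y" using AX XA by (metis matrix_mul_assoc)
  also have "\<dots> = Y" using assms by (simp add: is_pinv_def)
  finally show ?thesis .
qed

lemma orthogonal_projection_matrix_exists:
  fixes S :: "(real^'n) set"
  assumes "subspace S"
  obtains P :: "real^'n^'n" where "transpose P = P" "\<And>y. P *v y \<in> S" "\<And>x. x \<in> S \<Longrightarrow> P *v x = x"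
proof -
  obtain B where B: "B \<subseteq> S" "pairwise orthogonal B" "\<And>x. x \<in> B \<Longrightarrow> norm x = 1"
      "independent B" "card B = dim S" "span B = S"
    using orthonormal_basis_subspace[OF assms] by blast
  have fB: "finite B" using B(4) independent_imp_finite by blast
  define p where "p = (\<lambda>y. \<Sum>b\<in>B. (b \<bullet> y) *\<^sub>R b)"
  have lin: "linear p"
    by (rule linearI) (simp_all add: p_def inner_add_right scaleR_add_left sum.distrib scaleR_sum_right)
  have pv: "matrix p *v y = p y" for y using lin by simp
  have sym: "p x \<bullet> y = x \<bullet> p y" for x y
    by (simp add: p_def inner_sum_left inner_sum_right inner_commute mult.commute)
  have "transpose (matrix p) = matrix p"
  proof -
    have "(transpose (matrix p) *v x) \<bullet> y = (matrix p *v x) \<bullet> y" for x y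
      using sym[of x y] pv by (metis dot_lmul_matrix transpose_matrix_vector)
    then have "transpose (matrix p) *v x = matrix p *v x" for x
      by (metis vector_eq_rdot)
    then show ?thesis by (simp add: matrix_eq)
  qed
  moreover have "p y \<in> S" for y
    unfolding p_def using B(1) assms by (intro subspace_sum subspace_scale) auto
  moreover have "p x = x" if "x \<in> S" for x
  proof -
    have pb: "p b = b" if "b \<in> B" for b
    proof -
      have "p b = (\<Sum>c\<in>B. if c = b then b else 0)"
        unfolding p_def
      proof (rule sum.cong[OF refl])
        fix c assume "c \<in> B"
        show "(c \<bullet> b) *\<^sub>R c = (if c = b then b else 0)"
        proof (cases "c = b")
          case True
          have "b \<bullet> b = 1" using B(3)[OF \<open>b \<in> B\<close>] by (simp add: norm_eq_1)
          then show ?thesis using True by simp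
        next
          case False
          then have "orthogonal c b" using B(2) \<open>c \<in> B\<close> \<open>b \<in> B\<close> by (auto simp: pairwise_def)
          then show ?thesis using False by (simp add: orthogonal_def)
        qed
      qed
      also have "\<dots> = b" using fB that by simp
      finally show ?thesis .
    qed
    have "x \<in> span B" using that B(6) by simp
    then show ?thesis
      using linear_eq_on[OF lin linear_id, of x B] pb by simp
  qed
  ultimately show thesis using that[of "matrix p"] pv by simp
qed

lemma is_pinv_exists:
  fixes A :: "real^'n^'m"
  shows "\<exists>X. is_pinv A X"
proof -
  let ?R = "range ((*v) A)" and ?N = "{x. A *v x = 0}"
  have linA: "linear ((*v) A)" by simp
  have "subspace ?R" using linear_subspace_image[OF linA subspace_UNIV] .
  then obtain P where P: "transpose P = P" "\<And>y. P *v y \<in> ?R" "\<And>x. x \<in> ?R \<Longrightarrow> P *v x = x"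
    using orthogonal_projection_matrix_exists[of ?R] by blast
  have "subspace ?N" using linear_subspace_kernel[OF linA] .
  then obtain Q where Q: "transpose Q = Q" "\<And>y. Q *v y \<in> ?N" "\<And>x. x \<in> ?N \<Longrightarrow> Q *v x = x"
    using orthogonal_projection_matrix_exists[of ?N] by blast
  define F where "F = mat 1 - Q"
  have Fsym: "transpose F = F"
  proof -
    have "transpose (mat 1 - Q) = transpose (mat 1) - transpose Q"
      by (simp add: transpose_def vec_eq_iff)
    then show ?thesis using Q(1) by (simp add: F_def transpose_mat)
  qed
  have Fv: "F *v x = x - Q *v x" for x by (simp add: F_def matrix_vector_mult_diff_rdistrib)
  have AF: "A *v (F *v x) = A *v x" for x
    using Q(2)[of x] by (simp add: Fv matrix_vector_mult_diff_distrib)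
  have FN: "F *v x = 0" if "A *v x = 0" for x using Q(3)[of x] that by (simp add: Fv)
  define sel where "sel = (\<lambda>y. SOME x. A *v x = P *v y)"
  have sel: "A *v sel y = P *v y" for y
    unfolding sel_def by (rule someI_ex) (metis P(2) imageE)
  have uniq: "F *v x = F *v x'" if "A *v x = A *v x'" for x x'
  proof -
    have "F *v (x - x') = 0" by (rule FN) (use that in \<open>simp add: matrix_vector_mult_diff_distrib\<close>)
    then show ?thesis by (simp add: matrix_vector_mult_diff_distrib)
  qed
  define h where "h = (\<lambda>y. F *v sel y)"
  have linh: "linear h"
  proof (rule linearI)
    fix x y
    have "F *v sel (x + y) = F *v (sel x + sel y)"
      by (rule uniq) (simp add: sel matrix_vector_right_distrib)
    then show "h (x + y) = h x + h y" by (simp add: h_def matrix_vector_right_distrib)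
  next
    fix r x
    have "F *v sel (r *\<^sub>R x) = F *v (r *\<^sub>R sel x)"
      by (rule uniq) (simp add: sel matrix_vector_mult_scaleR)
    then show "h (r *\<^sub>R x) = r *\<^sub>R h x" by (simp add: h_def matrix_vector_mult_scaleR)
  qed
  define X where "X = matrix h"
  have Xv: "X *v y = F *v sel y" for y using linh by (simp add: X_def h_def)
  have "A ** X = P" by (simp add: matrix_eq Xv AF sel flip: matrix_vector_mul_assoc)
  moreover have XA: "X ** A = F"
    by (simp add: matrix_eq Xv flip: matrix_vector_mul_assoc) (metis P(3) rangeI sel uniq)
  moreover have "P ** A = A" by (simp add: matrix_eq P(3) flip: matrix_vector_mul_assoc)
  moreover have "F ** X = X"
    by (simp add: matrix_eq Xv flip: matrix_vector_mul_assoc) (metis AF uniq)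
  ultimately show ?thesis using P(1) Fsym unfolding is_pinv_def by metis
qed

lemma is_pinv_pinv: "is_pinv A (pinv A)"
  unfolding pinv_def using is_pinv_exists is_pinv_unique by (metis theI')

section \<open>Kernel denoisers and the associated regularizer\<close>

definition diag :: "real^'n \<Rightarrow> real^'n^'n" where
  "diag d = (\<chi> i j. if i = j then d $ i else 0)"

definition kernel_matrix :: "real^'n^'n \<Rightarrow> bool" where
  "kernel_matrix K \<longleftrightarrow>
     transpose K = K \<and> (\<forall>x. 0 \<le> x \<bullet> (K *v x)) \<and>
     (\<forall>i j. 0 \<le> K $ i $ j) \<and> (\<forall>i. 0 < K $ i $ i)"

text \<open>The constant \<open>1\<close> of type \<open>real^'n\<close> is the all-ones vector.\<close>

definition degrees :: "real^'n^'n \<Rightarrow> real^'n" where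
  "degrees K = K *v 1"

definition deg_mat :: "real^'n^'n \<Rightarrow> real^'n^'n" where
  "deg_mat K = diag (degrees K)"

definition deg_sqrt :: "real^'n^'n \<Rightarrow> real^'n^'n" where
  "deg_sqrt K = diag (\<chi> i. sqrt (degrees K $ i))"

definition deg_inv_sqrt :: "real^'n^'n \<Rightarrow> real^'n^'n" where
  "deg_inv_sqrt K = diag (\<chi> i. 1 / sqrt (degrees K $ i))"

definition kernel_denoiser :: "real^'n^'n \<Rightarrow> real^'n^'n" where
  "kernel_denoiser K = matrix_inv (deg_mat K) ** K"

definition sym_denoiser :: "real^'n^'n \<Rightarrow> real^'n^'n" where
  "sym_denoiser K = deg_inv_sqrt K ** K ** deg_inv_sqrt K"

definition sym_regularizer :: "real^'n^'n \<Rightarrow> real^'n \<Rightarrow> ereal" where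
  "sym_regularizer S x =
     ereal (1 / 2 * (x \<bullet> ((pinv S ** (mat 1 - S)) *v x))) + iota (range ((*v) S)) x"

text \<open>The regularizer of \<open>W = D\<^sup>-\<^sup>1 K\<close> is a function of \<open>K\<close> and not of \<open>W\<close> alone: rescaling \<open>K\<close> leaves \<open>W\<close>
  unchanged but rescales \<open>D\<close>.\<close>

definition denoiser_regularizer :: "real^'n^'n \<Rightarrow> real^'n \<Rightarrow> ereal" where
  "denoiser_regularizer K x = sym_regularizer (sym_denoiser K) (deg_sqrt K *v x)"

definition deg_inner :: "real^'n^'n \<Rightarrow> real^'n \<Rightarrow> real^'n \<Rightarrow> real" where
  "deg_inner K x y = x \<bullet> (deg_mat K *v y)"

text \<open>Irreducibility in graph form: the directed graph of the nonzero entries is strongly connected.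
  A \<open>kernel_matrix\<close> need not be irreducible: the identity is a kernel matrix, its denoiser is the
  identity, and its regularizer vanishes identically.\<close>

definition irreducible_matrix :: "real^'n^'n \<Rightarrow> bool" where
  "irreducible_matrix M \<longleftrightarrow> (\<forall>i j. (i, j) \<in> {(i, j). M $ i $ j \<noteq> 0}\<^sup>*)"

section \<open>Forward operators\<close>

text \<open>Row \<open>k\<close> of a sampling operator reads the pixel \<open>s k\<close>, distinct rows reading distinct pixels. Allowing
  zero rows (\<open>s k = None\<close>) covers both usual forms of a sampling operator: the rows of the identity
  that belong to the observed pixels, and the square diagonal 0/1 mask.\<close>

definition sampling_operator :: "real^'n^'m \<Rightarrow> bool" where
  "sampling_operator S \<longleftrightarrow>
     (\<exists>s :: 'm \<Rightarrow> 'n option.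
        inj_on s (dom s) \<and> dom s \<noteq> {} \<and>
        S = (\<chi> k j. if s k = Some j then 1 else 0))"

text \<open>Pixels of an \<open>h \<times> w\<close> image are identified with indices by an arbitrary enumeration. To convolve, the
  image is first extended to the whole plane by folding each coordinate back into range;
  \<open>\<lambda>t. t mod N\<close> gives the periodic extension (circular convolution), and replicated and
  mirrored boundaries are further instances.\<close>

definition pixel_grid :: "nat \<Rightarrow> nat \<Rightarrow> (int \<times> int) set" where
  "pixel_grid h w = {0..<int h} \<times> {0..<int w}"

definition boundary_rule :: "nat \<Rightarrow> (int \<Rightarrow> int) \<Rightarrow> bool" where
  "boundary_rule N c \<longleftrightarrow>
     (\<forall>t. c t \<in> {0..<int N}) \<and> (\<forall>t\<in>{0..<int N}. c t = t)"

definition extend_image ::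
  "('n \<Rightarrow> int \<times> int) \<Rightarrow> (int \<Rightarrow> int) \<Rightarrow> (int \<Rightarrow> int) \<Rightarrow> real^'n \<Rightarrow> int \<times> int \<Rightarrow> real" where
  "extend_image p c d x = (\<lambda>(r, s). x $ (inv p (c r, d s)))"

definition convolve :: "(int \<times> int \<Rightarrow> real) \<Rightarrow> (int \<times> int \<Rightarrow> real) \<Rightarrow> int \<times> int \<Rightarrow> real" where
  "convolve k g v = (\<Sum>u | k u \<noteq> 0. k u * g (fst v - fst u, snd v - snd u))"

text \<open>Input and output image live on the same grid, but are indexed by possibly different types
  (through the enumerations \<open>p\<close> and \<open>q\<close>), so that a blur can be compared with a general forward operator.\<close>

definition blur_operator :: "real^'n^'m \<Rightarrow> bool" where
  "blur_operator B \<longleftrightarrow>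
     (\<exists>h w (p :: 'n \<Rightarrow> int \<times> int) (q :: 'm \<Rightarrow> int \<times> int) c d (k :: int \<times> int \<Rightarrow> real).
        bij_betw p UNIV (pixel_grid h w) \<and> bij_betw q UNIV (pixel_grid h w) \<and>
        boundary_rule h c \<and> boundary_rule w d \<and>
        finite {u. k u \<noteq> 0} \<and> (\<forall>u. 0 \<le> k u) \<and> (\<exists>u. k u \<noteq> 0) \<and>
        (\<forall>x i. (B *v x) $ i = convolve k (extend_image p c d x) (q i)))"

definition inpainting_operator :: "real^'n^'m \<Rightarrow> bool" where
  "inpainting_operator A \<longleftrightarrow> sampling_operator A"

definition deblurring_operator :: "real^'n^'m \<Rightarrow> bool" where
  "deblurring_operator A \<longleftrightarrow> blur_operator A"

definition superresolution_operator :: "real^'n^'m \<Rightarrow> bool" where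
  "superresolution_operator A \<longleftrightarrow>
     (\<exists>(S :: real^'n^'m) (B :: real^'n^'n). sampling_operator S \<and> blur_operator B \<and> A = S ** B)"

definition objective ::
  "real^'n^'m \<Rightarrow> real^'m \<Rightarrow> real \<Rightarrow> real^'n^'n \<Rightarrow> real^'n \<Rightarrow> ereal" where
  "objective A b \<rho> K x =
     ereal (1 / 2 * (norm (A *v x - b))\<^sup>2) + ereal \<rho> * denoiser_regularizer K x"

end

theory Submission
  imports Defs
begin

text \<open>With \<open>z = D\<^sup>1\<^sup>/\<^sup>2 x = S u\<close> in the range of \<open>S = W\<^sub>s\<close>, the quadratic form of the regularizer is
  \<open>u \<bullet> (S - S\<^sup>2) u\<close>. Since \<open>S - S\<^sup>2 = S (I - S) S + (I - S) S (I - S)\<close> and \<open>S \<ge> 0\<close>, it is at least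
  \<open>z \<bullet> (I - S) z = x \<bullet> (D - K) x\<close>, which is the Dirichlet energy \<open>\<Sum> K\<^sub>i\<^sub>j (x\<^sub>i - x\<^sub>j)\<^sup>2 / 2\<close>. By
  irreducibility this energy vanishes only on constant images, and no forward operator of the three
  kinds annihilates those. Hence, on its domain, a linear subspace, the objective is a quadratic
  function whose leading form dominates a positive definite form; compactness of the unit sphere
  yields the modulus.\<close>

section \<open>Quadratic functions on a subspace\<close>

lemma ereal_plus_iota: "ereal a + iota V x = (if x \<in> V then ereal a else \<infinity>)"
  by (simp add: iota_def)

text \<open>\<open>q\<close> is the leading form of \<open>g\<close>. As \<open>quad\<close> is an
  exact identity and differences of points of \<open>V\<close> stay in \<open>V\<close>, strong
  convexity reduces to coercivity of \<open>q\<close> on \<open>V\<close>.\<close>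

lemma strongly_convex_quadratic_on_subspace:
  fixes g q :: "'a::{real_normed_vector} \<Rightarrow> real"
  assumes V: "subspace V" "closed V" and cont: "continuous_on UNIV g"
    and quad: "\<And>x y \<theta>. g (\<theta> *\<^sub>R x + (1 - \<theta>) *\<^sub>R y) =
      \<theta> * g x + (1 - \<theta>) * g y - \<theta> * (1 - \<theta>) * q (x - y)"
    and "0 < \<mu>" and coercive: "\<And>x. x \<in> V \<Longrightarrow> \<mu> / 2 * (ip_norm ip x)\<^sup>2 \<le> q x"
  shows "strongly_convex ip (\<lambda>x. ereal (g x) + iota V x)"
proof -
  define f where "f = (\<lambda>x. ereal (g x) + iota V x)"
  have f: "f x = (if x \<in> V then ereal (g x) else \<infinity>)" for x
    by (simp add: f_def ereal_plus_iota)
  have in_V: "\<theta> *\<^sub>R x + (1 - \<theta>) *\<^sub>R y \<in> V" if "x \<in> V" "y \<in> V" for x y \<theta>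
    using V(1) that by (intro subspace_add subspace_scale)
  have ineq: "g (\<theta> *\<^sub>R x + (1 - \<theta>) *\<^sub>R y)
      \<le> \<theta> * g x + (1 - \<theta>) * g y - \<mu> / 2 * \<theta> * (1 - \<theta>) * (ip_norm ip (x - y))\<^sup>2"
    if "x \<in> V" "y \<in> V" "0 \<le> \<theta>" "\<theta> \<le> 1" for x y \<theta>
  proof -
    have "\<theta> * (1 - \<theta>) * (\<mu> / 2 * (ip_norm ip (x - y))\<^sup>2) \<le> \<theta> * (1 - \<theta>) * q (x - y)"
      using that V(1) by (intro mult_left_mono coercive subspace_diff) auto
    then show ?thesis unfolding quad by (simp add: mult_ac)
  qed
  have epi: "ext_epigraph f = (V \<times> UNIV) \<inter> {p. g (fst p) \<le> snd p}"
    by (auto simp: ext_epigraph_def f split: if_splits)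
  have "proper_fun f"
    using subspace_0[OF V(1)] by (auto simp: proper_fun_def f intro!: exI[of _ 0])
  moreover have "closed_fun f"
    unfolding closed_fun_def epi
    by (intro closed_Int closed_Times V(2) closed_UNIV closed_Collect_le
        continuous_intros continuous_on_compose2[OF cont]) auto
  moreover have "convex_fun f"
    unfolding convex_fun_def convex_alt epi
  proof (intro ballI allI impI, clarsimp, intro conjI)
    fix x y r s and u :: real
    assume *: "x \<in> V" "y \<in> V" "g x \<le> r" "g y \<le> s" "0 \<le> u" "u \<le> 1"
    show "(1 - u) *\<^sub>R x + u *\<^sub>R y \<in> V"
      using in_V[OF *(2,1), of u] by (simp add: add.commute)
    \<comment> \<open>\<open>convex_alt\<close> puts the weight \<open>u\<close> on the second
      point, so \<open>ineq\<close> is used with \<open>x\<close> and \<open>y\<close>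
      exchanged.\<close>
    have "g (u *\<^sub>R y + (1 - u) *\<^sub>R x) \<le> u * g y + (1 - u) * g x
        - \<mu> / 2 * u * (1 - u) * (ip_norm ip (y - x))\<^sup>2"
      using * by (intro ineq)
    also have "\<dots> \<le> u * g y + (1 - u) * g x"
      using * \<open>0 < \<mu>\<close> by simp
    also have "\<dots> \<le> u * s + (1 - u) * r"
      using * by (intro add_mono mult_left_mono) auto
    finally show "g ((1 - u) *\<^sub>R x + u *\<^sub>R y) \<le> (1 - u) * r + u * s"
      by (simp add: add.commute)
  qed
  moreover have "f (\<theta> *\<^sub>R x + (1 - \<theta>) *\<^sub>R y) \<le> ereal \<theta> * f x + ereal (1 - \<theta>) * f y
      - ereal (\<mu> / 2 * \<theta> * (1 - \<theta>) * (ip_norm ip (x - y))\<^sup>2)"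
    if \<theta>: "\<theta> \<in> {0..1}" for x y \<theta>
  proof -
    \<comment> \<open>At an endpoint a weight 0 may meet an infinite value. Inside, both weights are
      positive, so one point off \<open>V\<close> makes the right-hand side infinite.\<close>
    consider "\<theta> = 0" | "\<theta> = 1" | "0 < \<theta>" "\<theta> < 1" using \<theta> by fastforce
    then show ?thesis
    proof cases
      case 1
      then show ?thesis by (simp add: zero_ereal_def[symmetric] one_ereal_def[symmetric])
    next
      case 2
      then show ?thesis by (simp add: zero_ereal_def[symmetric] one_ereal_def[symmetric])
    next
      case 3
      show ?thesis
      proof (cases "x \<in> V \<and> y \<in> V")
        case True
        then show ?thesis using ineq[of x y \<theta>] in_V[of x y \<theta>] 3 by (simp add: f)
      next
        case False
        then show ?thesis using 3 by (auto simp: f)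
      qed
    qed
  qed
  ultimately show ?thesis
    using \<open>0 < \<mu>\<close> unfolding strongly_convex_def f_def[symmetric] by blast
qed

text \<open>The ratio \<open>E x / N x\<close> is constant along rays by homogeneity, so its
  positive minimum over the unit sphere serves as the constant.\<close>

lemma homogeneous_quadratic_comparison:
  fixes E N :: "'a::euclidean_space \<Rightarrow> real"
  assumes cont: "continuous_on UNIV E" "continuous_on UNIV N"
    and hom: "\<And>c x. E (c *\<^sub>R x) = c\<^sup>2 * E x" "\<And>c x. N (c *\<^sub>R x) = c\<^sup>2 * N x"
    and pos: "\<And>x. x \<noteq> 0 \<Longrightarrow> 0 < E x" "\<And>x. x \<noteq> 0 \<Longrightarrow> 0 < N x"
  shows "\<exists>\<mu>>0. \<forall>x. \<mu> * N x \<le> E x"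
proof -
  let ?S = "sphere (0::'a) 1"
  have nz: "x \<noteq> 0" if "x \<in> ?S" for x using that by auto
  have "continuous_on ?S (\<lambda>x. E x / N x)"
    by (intro continuous_on_divide continuous_on_subset[OF cont(1)] continuous_on_subset[OF cont(2)])
      (auto dest!: nz pos(2))
  moreover have "?S \<noteq> {}" using SOME_Basis by (auto simp: sphere_def dist_norm intro!: norm_Basis)
  ultimately obtain a where a: "a \<in> ?S" "\<And>x. x \<in> ?S \<Longrightarrow> E a / N a \<le> E x / N x"
    using continuous_attains_inf[OF compact_sphere, of 0 1 "\<lambda>x. E x / N x"] by blast
  have "E a / N a * N x \<le> E x" for x
  proof (cases "x = 0")
    case True
    then show ?thesis using hom(1)[of 0 0] hom(2)[of 0 0] by simp
  next
    case False
    define y where "y = x /\<^sub>R norm x"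
    have y: "y \<in> ?S" "x = norm x *\<^sub>R y" using False by (simp_all add: y_def)
    have "E a / N a * N y \<le> E y"
      using a(2)[OF y(1)] pos(2)[OF nz[OF y(1)]] by (simp add: pos_le_divide_eq)
    then have "(norm x)\<^sup>2 * (E a / N a * N y) \<le> (norm x)\<^sup>2 * E y"
      by (intro mult_left_mono) auto
    then show ?thesis
      using hom(1)[of "norm x" y] hom(2)[of "norm x" y] y(2) by (simp add: mult.left_commute)
  qed
  moreover have "0 < E a / N a" using pos nz[OF a(1)] by simp
  ultimately show ?thesis by blast
qed

text \<open>The mixed terms in \<open>x, y\<close> and in \<open>y, x\<close> match separately, so
  \<open>M\<close> may be taken as \<open>pinv S ** (mat 1 - S)\<close> directly.\<close>

lemma quadratic_form_convex_combination:
  fixes M :: "real^'n^'n"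
  shows "(\<theta> *\<^sub>R x + (1 - \<theta>) *\<^sub>R y) \<bullet> (M *v (\<theta> *\<^sub>R x + (1 - \<theta>) *\<^sub>R y)) =
    \<theta> * (x \<bullet> (M *v x)) + (1 - \<theta>) * (y \<bullet> (M *v y))
      - \<theta> * (1 - \<theta>) * ((x - y) \<bullet> (M *v (x - y)))"
  by (simp add: matrix_vector_right_distrib matrix_vector_mult_diff_distrib
      matrix_vector_mult_scaleR inner_add_left inner_add_right inner_diff_left inner_diff_right)
    (simp add: algebra_simps)

lemma norm_square_convex_combination:
  fixes x y :: "'a::real_inner"
  shows "(norm (\<theta> *\<^sub>R x + (1 - \<theta>) *\<^sub>R y))\<^sup>2 =
    \<theta> * (norm x)\<^sup>2 + (1 - \<theta>) * (norm y)\<^sup>2 - \<theta> * (1 - \<theta>) * (norm (x - y))\<^sup>2"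
  by (simp add: power2_norm_eq_inner inner_add_left inner_add_right inner_diff_left
      inner_diff_right inner_commute algebra_simps)

section \<open>Symmetric matrices and the Dirichlet energy\<close>

lemma symmetric_matrix_inner:
  fixes S :: "real^'n^'n"
  assumes "transpose S = S"
  shows "(S *v x) \<bullet> y = x \<bullet> (S *v y)"
  using assms by (metis dot_lmul_matrix transpose_matrix_vector)

text \<open>With \<open>z = S u\<close>, the right side minus the left is exactly the form of
  \<open>S\<close> at \<open>u - z\<close>.\<close>

lemma pinv_symmetric_quadratic_form_ge:
  fixes S :: "real^'n^'n"
  assumes sym: "transpose S = S" and psd: "\<And>x. 0 \<le> x \<bullet> (S *v x)" and z: "z \<in> range ((*v) S)"
  shows "z \<bullet> z - z \<bullet> (S *v z) \<le> z \<bullet> ((pinv S ** (mat 1 - S)) *v z)"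
proof -
  let ?X = "pinv S"
  obtain u where u: "z = S *v u" using z by blast
  have X: "S ** ?X ** S = S" "transpose (?X ** S) = ?X ** S"
    using is_pinv_pinv[of S] by (simp_all add: is_pinv_def)
  have XS: "(?X *v (S *v v)) \<bullet> w = v \<bullet> (?X *v (S *v w))" for v w
    using symmetric_matrix_inner[OF X(2), of v w] by (simp add: matrix_vector_mul_assoc)
  have SXS: "S *v (?X *v (S *v v)) = S *v v" for v
    using X(1) by (simp add: matrix_vector_mul_assoc matrix_mul_assoc)
  \<comment> \<open>Here and in the next product, symmetry moves the \<open>S\<close> of
    \<open>z = S u\<close> across the inner product; the resulting \<open>S ?X S\<close> collapses
    to \<open>S\<close>.\<close>
  have zXz: "z \<bullet> (?X *v z) = u \<bullet> z"
    using symmetric_matrix_inner[OF sym] SXS by (simp add: u)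
  have "z \<bullet> (?X *v (S *v z)) = z \<bullet> z"
    using XS[of z z] symmetric_matrix_inner[OF sym] SXS by (simp add: u)
  then have q: "z \<bullet> ((?X ** (mat 1 - S)) *v z) = u \<bullet> z - z \<bullet> z"
    using zXz by (simp add: matrix_vector_mul_assoc[symmetric] matrix_vector_mult_diff_rdistrib
        matrix_vector_mult_diff_distrib inner_diff_right)
  have "0 \<le> (u - z) \<bullet> (S *v (u - z))" by (rule psd)
  also have "\<dots> = u \<bullet> z - 2 * (z \<bullet> z) + z \<bullet> (S *v z)"
    using symmetric_matrix_inner[OF sym, of u z]
    by (simp add: matrix_vector_mult_diff_distrib inner_diff_left inner_diff_right u[symmetric])
  finally show ?thesis using q by simp
qed

text \<open>For symmetric \<open>K\<close>, this is the quadratic form of the graph Laplacian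
  \<open>D - K\<close>; the half compensates for counting ordered pairs.\<close>

definition dirichlet_energy :: "real^'n^'n \<Rightarrow> real^'n \<Rightarrow> real" where
  "dirichlet_energy K x = (\<Sum>i\<in>UNIV. \<Sum>j\<in>UNIV. K $ i $ j * (x $ i - x $ j)\<^sup>2) / 2"

lemma dirichlet_energy_scaleR: "dirichlet_energy K (c *\<^sub>R x) = c\<^sup>2 * dirichlet_energy K x"
proof -
  have "K $ i $ j * (c * x $ i - c * x $ j)\<^sup>2 = c\<^sup>2 * (K $ i $ j * (x $ i - x $ j)\<^sup>2)" for i j
    by (simp add: power2_eq_square algebra_simps)
  then show ?thesis
    by (simp only: dirichlet_energy_def vector_scaleR_component real_scaleR_def
        sum_distrib_left[symmetric] times_divide_eq_right)
qed

lemma diag_mult_vector [simp]: "(diag d *v x) $ i = d $ i * x $ i"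
  by (simp add: diag_def matrix_vector_mult_def if_distrib if_distribR cong: if_cong)

lemma transpose_diag [simp]: "transpose (diag d) = diag d"
  by (simp add: transpose_def diag_def vec_eq_iff)

lemma matrix_inv_diag:
  assumes "\<And>i. d $ i \<noteq> 0"
  shows "matrix_inv (diag d) = diag (\<chi> i. 1 / d $ i)"
proof -
  let ?d = "diag d" and ?e = "diag (\<chi> i. 1 / d $ i)"
  have inv: "?d ** ?e = mat 1" "?e ** ?d = mat 1"
    by (simp_all add: matrix_eq matrix_vector_mul_assoc[symmetric] vec_eq_iff assms)
  \<comment> \<open>\<open>matrix_inv\<close> is a choice among two-sided inverses, so uniqueness is
    what identifies it.\<close>
  have uniq: "X = ?e" if "?d ** X = mat 1 \<and> X ** ?d = mat 1" for X
  proof -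
    have "X = X ** (?d ** ?e)" by (simp add: inv)
    also have "\<dots> = ?e" using that by (simp add: matrix_mul_assoc)
    finally show ?thesis .
  qed
  show ?thesis unfolding matrix_inv_def
  proof (rule some_equality)
    show "?d ** ?e = mat 1 \<and> ?e ** ?d = mat 1" using inv by simp
  qed (rule uniq)
qed

lemma degrees_pos:
  assumes "kernel_matrix K"
  shows "0 < degrees K $ i"
proof -
  have "0 < (\<Sum>j\<in>UNIV. K $ i $ j)"
    using assms by (intro sum_pos2[of UNIV i]) (auto simp: kernel_matrix_def)
  then show ?thesis by (simp add: degrees_def matrix_vector_mult_def)
qed

text \<open>Expanding the square gives two diagonal sums, which agree by symmetry after swapping the
  indices, and a cross term.\<close>

lemma dirichlet_energy_eq:
  assumes "transpose K = K"
  shows "dirichlet_energy K x = x \<bullet> (deg_mat K *v x) - x \<bullet> (K *v x)"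
proof -
  have symK: "K $ i $ j = K $ j $ i" for i j using assms by (metis transpose_def vec_lambda_beta)
  have D: "x \<bullet> (deg_mat K *v x) = (\<Sum>i\<in>UNIV. \<Sum>j\<in>UNIV. K $ i $ j * (x $ i)\<^sup>2)"
    by (simp add: inner_vec_def deg_mat_def)
      (simp add: degrees_def matrix_vector_mult_def sum_distrib_left sum_distrib_right
        power2_eq_square mult_ac)
  also have "\<dots> = (\<Sum>i\<in>UNIV. \<Sum>j\<in>UNIV. K $ i $ j * (x $ j)\<^sup>2)"
    by (subst sum.swap) (simp add: symK)
  finally have D': "x \<bullet> (deg_mat K *v x) = (\<Sum>i\<in>UNIV. \<Sum>j\<in>UNIV. K $ i $ j * (x $ j)\<^sup>2)" .
  have "2 * dirichlet_energy K x = (\<Sum>i\<in>UNIV. \<Sum>j\<in>UNIV. K $ i $ j * (x $ i)\<^sup>2)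
      + (\<Sum>i\<in>UNIV. \<Sum>j\<in>UNIV. K $ i $ j * (x $ j)\<^sup>2)
      - 2 * (\<Sum>i\<in>UNIV. \<Sum>j\<in>UNIV. x $ i * (K $ i $ j * x $ j))"
  proof -
    have "K $ i $ j * (x $ i - x $ j)\<^sup>2 = K $ i $ j * (x $ i)\<^sup>2 + K $ i $ j * (x $ j)\<^sup>2
        - 2 * (x $ i * (K $ i $ j * x $ j))" for i j
      by (simp add: power2_eq_square algebra_simps)
    then show ?thesis
      by (simp add: dirichlet_energy_def sum.distrib sum_subtractf
          sum_distrib_left[symmetric])
  qed
  also have "(\<Sum>i\<in>UNIV. \<Sum>j\<in>UNIV. x $ i * (K $ i $ j * x $ j)) = x \<bullet> (K *v x)"
    by (simp add: inner_vec_def matrix_vector_mult_def sum_distrib_left)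
  finally show ?thesis using D D' by simp
qed

text \<open>A vanishing sum of nonnegative terms forces equal values across every edge, hence along
  every path.\<close>

lemma constant_if_dirichlet_energy_zero:
  assumes K: "kernel_matrix K" and irr: "irreducible_matrix (kernel_denoiser K)"
    and zero: "dirichlet_energy K x = 0"
  shows "x $ i = x $ j"
proof -
  have nonneg: "0 \<le> K $ i $ j * (x $ i - x $ j)\<^sup>2" for i j
    using K by (simp add: kernel_matrix_def)
  have term0: "K $ i $ j * (x $ i - x $ j)\<^sup>2 = 0" for i j
    using zero by (simp add: dirichlet_energy_def sum_nonneg_eq_0_iff sum_nonneg nonneg)
  \<comment> \<open>Scaling rows by positive factors keeps the support, so \<open>W\<close> and
    \<open>K\<close> have the same graph.\<close>
  have "kernel_denoiser K $ i $ j = K $ i $ j / degrees K $ i" for i j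
    using degrees_pos[OF K]
    by (simp add: kernel_denoiser_def deg_mat_def matrix_inv_diag less_imp_neq[symmetric])
      (simp add: matrix_matrix_mult_def diag_def if_distrib if_distribR cong: if_cong)
  then have edge: "x $ i = x $ j" if "kernel_denoiser K $ i $ j \<noteq> 0" for i j
    using that term0[of i j] by auto
  have "(i, j) \<in> {(i, j). kernel_denoiser K $ i $ j \<noteq> 0}\<^sup>*"
    using irr by (simp add: irreducible_matrix_def)
  then show ?thesis by induction (auto dest: edge)
qed

section \<open>The regularizer\<close>

lemma deg_sqrt_inner:
  assumes "kernel_matrix K"
  shows "(deg_sqrt K *v x) \<bullet> (deg_sqrt K *v x) = x \<bullet> (deg_mat K *v x)"
proof -
  have "sqrt (degrees K $ i) * x $ i * (sqrt (degrees K $ i) * x $ i)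
      = x $ i * (degrees K $ i * x $ i)" for i
  proof -
    have "sqrt (degrees K $ i) * sqrt (degrees K $ i) = degrees K $ i"
      using degrees_pos[OF assms, of i] by simp
    moreover have "sqrt (degrees K $ i) * x $ i * (sqrt (degrees K $ i) * x $ i)
        = x $ i * (sqrt (degrees K $ i) * sqrt (degrees K $ i) * x $ i)" by (simp only: mult_ac)
    ultimately show ?thesis by simp
  qed
  then show ?thesis
    by (simp only: inner_vec_def deg_sqrt_def deg_mat_def diag_mult_vector vec_lambda_beta
        inner_real_def)
qed

text \<open>Used twice: to pass positive semidefiniteness from \<open>K\<close> to
  \<open>W_s\<close>, and to turn the form of \<open>W_s\<close> at \<open>D^(1/2) x\<close> into
  that of \<open>K\<close> at \<open>x\<close>.\<close>

lemma sym_denoiser_inner: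
  "y \<bullet> (sym_denoiser K *v y) = (deg_inv_sqrt K *v y) \<bullet> (K *v (deg_inv_sqrt K *v y))"
  by (simp add: sym_denoiser_def matrix_vector_mul_assoc[symmetric] deg_inv_sqrt_def
      symmetric_matrix_inner)

lemma regularizer_form_ge_dirichlet_energy:
  assumes K: "kernel_matrix K" and x: "deg_sqrt K *v x \<in> range ((*v) (sym_denoiser K))"
  defines "S \<equiv> sym_denoiser K" and "z \<equiv> deg_sqrt K *v x"
  shows "dirichlet_energy K x \<le> z \<bullet> ((pinv S ** (mat 1 - S)) *v z)"
proof -
  have symK: "transpose K = K" and psdK: "\<And>x. 0 \<le> x \<bullet> (K *v x)"
    using K by (simp_all add: kernel_matrix_def)
  have "transpose S = S"
    by (simp add: S_def sym_denoiser_def matrix_transpose_mul symK deg_inv_sqrt_def matrix_mul_assoc)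
  moreover have "0 \<le> y \<bullet> (S *v y)" for y
    unfolding S_def sym_denoiser_inner by (rule psdK)
  moreover have "z \<in> range ((*v) S)" using x by (simp add: S_def z_def)
  ultimately have "z \<bullet> z - z \<bullet> (S *v z) \<le> z \<bullet> ((pinv S ** (mat 1 - S)) *v z)"
    by (rule pinv_symmetric_quadratic_form_ge)
  moreover have "deg_inv_sqrt K *v z = x"
    using degrees_pos[OF K]
    by (simp add: z_def vec_eq_iff deg_inv_sqrt_def deg_sqrt_def less_imp_neq[symmetric])
  ultimately show ?thesis
    unfolding dirichlet_energy_eq[OF symK] S_def sym_denoiser_inner
    by (simp add: deg_sqrt_inner[OF K] z_def)
qed

text \<open>Since \<open>\<rho>\<close> is positive, it leaves both values 0 and infinity of the
  indicator unchanged.\<close>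

lemma objective_eq_quadratic_plus_iota:
  fixes A :: "real^'n^'m" and K :: "real^'n^'n"
  assumes "0 < \<rho>"
  defines "S \<equiv> sym_denoiser K"
  shows "objective A b \<rho> K x =
    ereal (1 / 2 * (norm (A *v x - b))\<^sup>2
      + \<rho> / 2 * ((deg_sqrt K *v x) \<bullet> ((pinv S ** (mat 1 - S)) *v (deg_sqrt K *v x))))
    + iota {x. deg_sqrt K *v x \<in> range ((*v) S)} x"
  using assms(1)
  by (simp add: objective_def denoiser_regularizer_def sym_regularizer_def iota_def S_def)

section \<open>Forward operators on constant images\<close>

lemma sampling_operator_one_neq_0:
  assumes "sampling_operator S"
  shows "S *v 1 \<noteq> 0"
proof -
  obtain s :: "'b \<Rightarrow> 'a option" where s: "dom s \<noteq> {}"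
    "S = (\<chi> k j. if s k = Some j then 1 else 0)"
    using assms by (auto simp: sampling_operator_def)
  obtain k j where kj: "s k = Some j" using s(1) by (auto simp: dom_def)
  have "(S *v 1) $ k = 1" by (simp add: s(2) matrix_vector_mult_def kj)
  then show ?thesis by auto
qed

text \<open>Every boundary rule extends a constant image to a constant, so convolution multiplies it
  by the sum of the blur kernel, which is positive.\<close>

lemma blur_operator_one:
  assumes "blur_operator B"
  shows "\<exists>c>0. B *v 1 = c *\<^sub>R 1"
proof -
  obtain p :: "'a \<Rightarrow> int \<times> int" and q :: "'b \<Rightarrow> int \<times> int" and c d k
    where k: "finite {u. k u \<noteq> 0}" "\<forall>u. 0 \<le> k u" "\<exists>u. k u \<noteq> 0"
      "\<forall>x i. (B *v x) $ i = convolve k (extend_image p c d x) (q i)"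
    using assms unfolding blur_operator_def by blast
  have "(B *v 1) $ i = (\<Sum>u | k u \<noteq> 0. k u)" for i
    using k(4) by (simp add: convolve_def extend_image_def)
  then have "B *v 1 = (\<Sum>u | k u \<noteq> 0. k u) *\<^sub>R 1" by (simp add: vec_eq_iff)
  moreover have "0 < (\<Sum>u | k u \<noteq> 0. k u)"
    using k by (intro sum_pos) (auto simp: order_less_le)
  ultimately show ?thesis by blast
qed

lemma forward_operator_one_neq_0:
  assumes "inpainting_operator A \<or> deblurring_operator A \<or> superresolution_operator A"
  shows "A *v 1 \<noteq> 0"
  using assms
proof (elim disjE)
  assume "inpainting_operator A"
  then show ?thesis by (simp add: inpainting_operator_def sampling_operator_one_neq_0)
next
  assume "deblurring_operator A"
  then obtain c where "0 < c" "A *v 1 = c *\<^sub>R 1"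
    using blur_operator_one by (auto simp: deblurring_operator_def)
  then show ?thesis by simp
next
  assume "superresolution_operator A"
  then obtain S :: "real^'a^'b" and B :: "real^'a^'a"
    where SB: "sampling_operator S" "blur_operator B" "A = S ** B"
    by (auto simp: superresolution_operator_def)
  obtain c where c: "0 < c" "B *v 1 = c *\<^sub>R 1" using blur_operator_one[OF SB(2)] by blast
  have "A *v 1 = c *\<^sub>R (S *v 1)"
    by (simp add: SB(3) c(2) matrix_vector_mul_assoc[symmetric] matrix_vector_mult_scaleR)
  then show ?thesis using c(1) sampling_operator_one_neq_0[OF SB(1)] by simp
qed

text \<open>Irreducibility excludes cases such as \<open>K = mat 1\<close>, where the regularizer
  vanishes and a mask that misses a pixel leaves the objective constant along that
  coordinate.\<close>

theorem corollary3p2: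
  fixes K W :: "real^'n^'n" and A :: "real^'n^'m" and b :: "real^'m" and \<rho> :: real
  assumes "kernel_matrix K" and "W = kernel_denoiser K"
    and "irreducible_matrix W"
    and "inpainting_operator A \<or> deblurring_operator A \<or> superresolution_operator A"
    and "0 < \<rho>"
  shows "strongly_convex (deg_inner K) (objective A b \<rho> K)"
proof -
  note K = assms(1)
  define S where "S = sym_denoiser K"
  define M where "M = pinv S ** (mat 1 - S)"
  define V where "V = {x. deg_sqrt K *v x \<in> range ((*v) S)}"
  define g where "g = (\<lambda>x. 1 / 2 * (norm (A *v x - b))\<^sup>2
    + \<rho> / 2 * ((deg_sqrt K *v x) \<bullet> (M *v (deg_sqrt K *v x))))"
  \<comment> \<open>The leading form of \<open>g\<close>: the data \<open>b\<close> affects only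
    lower-order terms.\<close>
  define q where "q = (\<lambda>x. 1 / 2 * (norm (A *v x))\<^sup>2
    + \<rho> / 2 * ((deg_sqrt K *v x) \<bullet> (M *v (deg_sqrt K *v x))))"
  \<comment> \<open>A minorant of \<open>q\<close> on \<open>V\<close> that is positive definite on
    the whole space, so the compactness argument can ignore \<open>V\<close>.\<close>
  define E where "E = (\<lambda>x. 1 / 2 * (norm (A *v x))\<^sup>2 + \<rho> / 2 * dirichlet_energy K x)"
  have E_le_q: "E x \<le> q x" if "x \<in> V" for x
    using regularizer_form_ge_dirichlet_energy[OF K, of x] that \<open>0 < \<rho>\<close>
    by (simp add: E_def q_def V_def S_def M_def)
  have E_pos: "0 < E x" if "x \<noteq> 0" for x
  proof -
    have nonneg: "0 \<le> dirichlet_energy K x"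
      using K by (auto simp: dirichlet_energy_def kernel_matrix_def intro!: sum_nonneg)
    show ?thesis
    proof (cases "dirichlet_energy K x = 0")
      case True
      \<comment> \<open>\<open>undefined\<close> is just some fixed pixel; all entries of
        \<open>x\<close> agree.\<close>
      have "x = (x $ undefined) *\<^sub>R 1"
        using constant_if_dirichlet_energy_zero[OF K _ True] assms(3) unfolding assms(2)
        by (simp add: vec_eq_iff)
      then obtain c where c: "x = c *\<^sub>R 1" ..
      then have "A *v x = c *\<^sub>R (A *v 1)" by (simp add: matrix_vector_mult_scaleR)
      then have "A *v x \<noteq> 0" using forward_operator_one_neq_0[OF assms(4)] c that by auto
      then show ?thesis using True by (simp add: E_def)
    next
      case False
      then show ?thesis using nonneg \<open>0 < \<rho>\<close> by (simp add: E_def add_nonneg_pos)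
    qed
  qed
  have weight: "x $ i * (degrees K $ i * x $ i) = degrees K $ i * (x $ i)\<^sup>2" for x i
    by (simp add: power2_eq_square)
  have N_pos: "0 < x \<bullet> (deg_mat K *v x)" if "x \<noteq> 0" for x
  proof -
    obtain i where i: "x $ i \<noteq> 0" using \<open>x \<noteq> 0\<close> by (auto simp: vec_eq_iff)
    have "0 < x $ i * (degrees K $ i * x $ i)"
      unfolding weight using i degrees_pos[OF K, of i] by simp
    moreover have "0 \<le> x $ i * (degrees K $ i * x $ i)" for i
      unfolding weight using degrees_pos[OF K, of i] by simp
    ultimately show ?thesis
      unfolding inner_vec_def deg_mat_def by (intro sum_pos2[of UNIV i]) auto
  qed
  have "\<exists>\<mu>>0. \<forall>x. \<mu> * (x \<bullet> (deg_mat K *v x)) \<le> E x"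
  proof (rule homogeneous_quadratic_comparison)
    show "continuous_on UNIV E" unfolding E_def dirichlet_energy_def
      by (intro continuous_intros linear_continuous_on_compose matrix_vector_mul_linear)
        auto
    show "continuous_on UNIV (\<lambda>x. x \<bullet> (deg_mat K *v x))"
      by (intro continuous_intros)
  qed (use E_pos N_pos in \<open>auto simp: E_def dirichlet_energy_scaleR matrix_vector_mult_scaleR
        power_mult_distrib power2_eq_square algebra_simps\<close>)
  then obtain \<mu> where \<mu>: "0 < \<mu>" "\<And>x. \<mu> * (x \<bullet> (deg_mat K *v x)) \<le> E x" by blast
  have ip: "(ip_norm (deg_inner K) x)\<^sup>2 = x \<bullet> (deg_mat K *v x)" for x
    using N_pos[of x] by (cases "x = 0") (auto simp: ip_norm_def deg_inner_def)
  have "strongly_convex (deg_inner K) (\<lambda>x. ereal (g x) + iota V x)"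
  proof (rule strongly_convex_quadratic_on_subspace)
    have "subspace (range ((*v) S))"
      by (intro linear_subspace_image matrix_vector_mul_linear subspace_UNIV)
    then show V: "subspace V"
      unfolding V_def
      using linear_subspace_vimage[of "(*v) (deg_sqrt K)"] by (simp add: vimage_def)
    show "closed V" using V by (rule closed_subspace)
    show "continuous_on UNIV g"
      unfolding g_def matrix_vector_mul_assoc by (intro continuous_intros)
    show "g (\<theta> *\<^sub>R x + (1 - \<theta>) *\<^sub>R y) = \<theta> * g x + (1 - \<theta>) * g y - \<theta> * (1 - \<theta>) * q (x - y)"
      for x y \<theta>
    proof -
      have "A *v (\<theta> *\<^sub>R x + (1 - \<theta>) *\<^sub>R y) - b = \<theta> *\<^sub>R (A *v x - b) + (1 - \<theta>) *\<^sub>R (A *v y - b)"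
        by (simp add: matrix_vector_right_distrib matrix_vector_mult_scaleR algebra_simps)
      moreover have "A *v (x - y) = (A *v x - b) - (A *v y - b)"
        and "deg_sqrt K *v (x - y) = deg_sqrt K *v x - deg_sqrt K *v y"
        by (simp_all add: matrix_vector_mult_diff_distrib)
      moreover have "deg_sqrt K *v (\<theta> *\<^sub>R x + (1 - \<theta>) *\<^sub>R y)
          = \<theta> *\<^sub>R (deg_sqrt K *v x) + (1 - \<theta>) *\<^sub>R (deg_sqrt K *v y)"
        by (simp add: matrix_vector_right_distrib matrix_vector_mult_scaleR)
      \<comment> \<open>Scalar bookkeeping that combines the two identities; \<open>b\<close> is a
        bound real here, not the data vector.\<close>
      moreover have "1 / 2 * (\<theta> * a + (1 - \<theta>) * b - \<theta> * (1 - \<theta>) * c)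
          + \<rho> / 2 * (\<theta> * d + (1 - \<theta>) * e - \<theta> * (1 - \<theta>) * h)
        = \<theta> * (1 / 2 * a + \<rho> / 2 * d) + (1 - \<theta>) * (1 / 2 * b + \<rho> / 2 * e)
          - \<theta> * (1 - \<theta>) * (1 / 2 * c + \<rho> / 2 * h)" for a b c d e h
        by (simp add: field_simps)
      ultimately show ?thesis
        unfolding g_def q_def
        by (simp only: norm_square_convex_combination quadratic_form_convex_combination)
    qed
    \<comment> \<open>The factor 2 cancels the half in the definition of strong convexity.\<close>
    show "0 < 2 * \<mu>" using \<mu>(1) by simp
    show "2 * \<mu> / 2 * (ip_norm (deg_inner K) x)\<^sup>2 \<le> q x" if "x \<in> V" for x
      using order_trans[OF \<mu>(2) E_le_q[OF that]] by (simp add: ip)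
  qed
  also have "(\<lambda>x. ereal (g x) + iota V x) = objective A b \<rho> K"
    using objective_eq_quadratic_plus_iota[OF \<open>0 < \<rho>\<close>, of A b K]
    by (auto simp: g_def V_def M_def S_def)
  finally show ?thesis .
qed

end
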